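(* Let $A\in M_2(\mathbb{Z})$ be an expanding matrix with $|\det(A)|=3$, let $k\in\mathbb{Z}\setminus\{0\}$, and let $v\in\mathbb{R}^2$ be such that $\{v,Av\}$ is linearly independent. Let $\mathcal{D}=\{0,v,kAv\}$. Then the self-affine set $T(A,\mathcal{D})$ is connected if and only if $k=\pm1$.
   Context: A real square matrix is expanding if all its eigenvalues have modulus strictly larger than $1$. For an expanding matrix $A\in M_n(\mathbb{Z})$ and a finite set $\mathcal{D}\subset\mathbb{R}^n$ with $|\mathcal D|=|\det A|$, the self-affine set $T(A,\mathcal{D})$ is the unique nonempty compact set $T$ with $AT=T+\mathcal{D}$; equivalently $T=\{\sum_{i=1}^\infty A^{-i}d_{j_i}: d_{j_i}\in\mathcal{D}\}$. *)

theory Defs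
  imports "HOL-Analysis.Analysis"
begin

text \<open>Integer matrix: all entries are integers.\<close>
definition int_matrix :: "real^'n^'n \<Rightarrow> bool" where
  "int_matrix A \<longleftrightarrow> (\<forall>i j. A$i$j \<in> \<int>)"

text \<open>Expanding: every (complex) eigenvalue, i.e. every complex root of
  det(A - z I) = 0, has modulus strictly larger than 1.\<close>
definition expanding :: "real^'n^'n \<Rightarrow> bool" where
  "expanding A \<longleftrightarrow>
     (\<forall>z::complex. det (\<chi> i j. complex_of_real (A$i$j) - (if i = j then z else 0)) = 0
        \<longrightarrow> cmod z > 1)"

text \<open>Self-affine set T(A,D) = { sum_{i>=1} A^{-i} d_i : d_i in D }.\<close>
definition self_affine_set :: "real^'n^'n \<Rightarrow> (real^'n) set \<Rightarrow> (real^'n) set" where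
  "self_affine_set A D =
     {x. \<exists>d::nat \<Rightarrow> real^'n. (\<forall>i. d i \<in> D) \<and>
          (\<lambda>i. (((*v) (matrix_inv A)) ^^ (Suc i)) (d i)) sums x}"

end

theory Submission
  imports Defs
begin

text \<open>Write \<open>T\<close> for the self-affine set. Two pieces \<open>A\<^sup>-\<^sup>1 (T + d)\<close> and \<open>A\<^sup>-\<^sup>1 (T + d')\<close> meet iff
  \<open>d - d' \<in> T - T\<close>, and \<open>T - T\<close> is the greatest bounded set in which every \<open>w\<close> has a successor
  \<open>A w - (d - d')\<close> with digits \<open>d\<close>, \<open>d'\<close>. If one piece meets the other two, then \<open>T\<close> is connected; if it is
  disjoint from them, then \<open>T\<close> is disconnected. In coordinates with respect to \<open>v\<close> and \<open>A v\<close> the successor map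
  acts on integer pairs and depends only on \<open>k\<close> and the characteristic polynomial \<open>t\<^sup>2 + p t + q\<close>, for which
  there are ten possibilities. For \<open>k = \<plusminus>1\<close> small finite sets closed under some successor show that one
  piece meets both others. For \<open>\<bar>k\<bar> \<ge> 2\<close> the second coordinate of an orbit satisfies
  \<open>\<bar>y (n + 2) + p y (n + 1) + q y n\<bar> \<le> \<bar>k\<bar> + 1\<close>; a bounded orbit therefore obeys an explicit bound, which is
  violated within a few steps when one starts at \<open>k A v\<close> or \<open>k A v - v\<close>, so the piece of the digit \<open>k A v\<close>
  is isolated.\<close>

subsection \<open>Attractors of affine function systems\<close>

text \<open>Tychonoff's theorem for the space of digit sequences.\<close>

lemma compact_sequences_in:
  fixes D :: "'a::topological_space set"
  assumes "compact D"
  shows "compact {d :: nat \<Rightarrow> 'a. \<forall>i. d i \<in> D}"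
proof -
  have "compactin (product_topology (\<lambda>i. euclidean) UNIV) (PiE UNIV (\<lambda>i::nat. D))"
    using assms by (subst compactin_PiE) auto
  moreover have "PiE UNIV (\<lambda>i::nat. D) = {d. \<forall>i. d i \<in> D}"
    by auto
  ultimately show ?thesis
    by (simp add: euclidean_product_topology)
qed

lemma linear_funpow:
  fixes L :: "'a::real_vector \<Rightarrow> 'a"
  assumes "linear L"
  shows "linear (L ^^ n)"
  by (induction n) (auto intro: linear_compose[of _ L, unfolded comp_def] linear_id
      simp: assms comp_def id_def linear_id[unfolded id_def])

text \<open>The inverse of an expanding matrix need not contract the Euclidean norm; summable bounds
  \<open>e n\<close> on its powers take the place of a contraction ratio.\<close>

locale affine_ifs =
  fixes L :: "'a::euclidean_space \<Rightarrow> 'a" and e :: "nat \<Rightarrow> real" and D :: "'a set"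
  assumes linear_L: "linear L"
    and summable_e: "summable e"
    and norm_pow: "norm ((L ^^ n) x) \<le> e n * norm x"
    and finite_D: "finite D" and D_nonempty: "D \<noteq> {}"
begin

definition attractor :: "'a set" where
  "attractor = {x. \<exists>d. (\<forall>i. d i \<in> D) \<and> (\<lambda>i. (L ^^ Suc i) (d i)) sums x}"

definition differences :: "'a set" where
  "differences = {s - t | s t. s \<in> attractor \<and> t \<in> attractor}"

lemma bounded_linear_pow: "bounded_linear (L ^^ n)"
  using linear_L linear_funpow linear_conv_bounded_linear by blast

lemma bounded_linear_L: "bounded_linear L"
  using bounded_linear_pow[of 1] by simp

lemma continuous_on_piece: "continuous_on X (\<lambda>x. L (d + x))"
  by (intro bounded_linear.continuous_on[OF bounded_linear_L] continuous_on_add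
      continuous_on_const continuous_on_id)

lemma e_nonneg: "e n \<ge> 0"
proof -
  obtain b :: 'a where "b \<in> Basis" by fastforce
  then have "norm b = 1" by simp
  then show ?thesis
    using order_trans[OF norm_ge_zero norm_pow[of n b]] by simp
qed

lemma D_bounded: obtains R where "R > 0" "\<And>d. d \<in> D \<Longrightarrow> norm d \<le> R"
  using finite_imp_bounded[OF finite_D] unfolding bounded_pos by blast

lemma summable_pow:
  assumes "\<And>i. norm (d i) \<le> R"
  shows "summable (\<lambda>i. (L ^^ Suc i) (d i))"
proof (rule summable_comparison_test')
  show "summable (\<lambda>i. e (Suc i) * R)"
    using summable_e by (intro summable_mult2) (subst summable_Suc_iff)
  show "norm ((L ^^ Suc i) (d i)) \<le> e (Suc i) * R" for i
    using norm_pow[of "Suc i" "d i"] mult_left_mono[OF assms e_nonneg] by (rule order_trans)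
qed

lemma digit_summable:
  assumes "\<And>i. d i \<in> D"
  shows "summable (\<lambda>i. (L ^^ Suc i) (d i))"
proof -
  obtain R where "\<And>d. d \<in> D \<Longrightarrow> norm d \<le> R" using D_bounded by blast
  then show ?thesis using assms by (intro summable_pow) blast
qed

lemma suminf_in_attractor:
  assumes "\<And>i. d i \<in> D"
  shows "(\<Sum>i. (L ^^ Suc i) (d i)) \<in> attractor"
  unfolding attractor_def mem_Collect_eq
  using assms summable_sums[OF digit_summable[of d]] by (intro exI[of _ d]) blast

lemma attractor_nonempty: "attractor \<noteq> {}"
  using D_nonempty suminf_in_attractor[of "\<lambda>_. SOME d. d \<in> D"] some_in_eq by blast

text \<open>The digit series converges uniformly by the M-test, hence is a continuous map from the
  compact sequence space onto the attractor.\<close>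

lemma attractor_compact: "compact attractor"
proof -
  let ?\<Omega> = "{d :: nat \<Rightarrow> 'a. \<forall>i. d i \<in> D}"
  let ?s = "\<lambda>d. \<Sum>i. (L ^^ Suc i) (d i)"
  obtain R where R: "R > 0" "\<And>d. d \<in> D \<Longrightarrow> norm d \<le> R" using D_bounded by blast
  have "uniform_limit ?\<Omega> (\<lambda>n d. \<Sum>i<n. (L ^^ Suc i) (d i)) ?s sequentially"
  proof (rule Weierstrass_m_test)
    show "summable (\<lambda>i. e (Suc i) * R)"
      using summable_e by (intro summable_mult2) (subst summable_Suc_iff)
    show "norm ((L ^^ Suc i) (d i)) \<le> e (Suc i) * R" if "d \<in> ?\<Omega>" for i d
      using norm_pow[of "Suc i" "d i"] that
        mult_left_mono[OF R(2) e_nonneg] by (blast intro: order_trans)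
  qed
  moreover have "continuous_on ?\<Omega> (\<lambda>d. \<Sum>i<n. (L ^^ Suc i) (d i))" for n
    by (intro continuous_on_sum bounded_linear.continuous_on[OF bounded_linear_pow])
      (rule continuous_on_subset[OF continuous_on_product_coordinates], simp)
  ultimately have "continuous_on ?\<Omega> ?s"
    by (intro uniform_limit_theorem[where F = sequentially]) auto
  moreover have "compact ?\<Omega>"
    by (rule compact_sequences_in) (simp add: finite_D finite_imp_compact)
  ultimately have "compact (?s ` ?\<Omega>)"
    by (rule compact_continuous_image)
  moreover have "attractor = ?s ` ?\<Omega>"
  proof -
    have "(\<lambda>i. (L ^^ Suc i) (d i)) sums ?s d" if "d \<in> ?\<Omega>" for d
      using that by (intro summable_sums digit_summable) simp
    then show ?thesis
      unfolding attractor_def by (force dest: sums_unique)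
  qed
  ultimately show ?thesis by simp
qed

lemma attractor_bounded: obtains R where "\<And>t. t \<in> attractor \<Longrightarrow> norm t \<le> R"
  using compact_imp_bounded[OF attractor_compact] bounded_iff by metis

lemma sums_prepend:
  assumes "(\<lambda>i. (L ^^ Suc i) (d (Suc i))) sums t"
  shows "(\<lambda>i. (L ^^ Suc i) (d i)) sums L (d 0 + t)"
proof -
  have "(\<lambda>i. L ((L ^^ Suc i) (d (Suc i)))) sums L t"
    by (rule bounded_linear.sums[OF bounded_linear_L assms])
  then have "(\<lambda>i. (L ^^ Suc (Suc i)) (d (Suc i))) sums L t"
    by simp
  then have "(\<lambda>i. (L ^^ Suc i) (d i)) sums (L t + (L ^^ Suc 0) (d 0))"
    by (rule sums_Suc_iff[THEN iffD1])
  then show ?thesis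
    by (simp add: linear_add[OF linear_L] add.commute)
qed

text \<open>The equation A T = T + D read through the inverse: splitting off or prepending a first
  digit.\<close>

lemma attractor_unfold: "attractor = (\<Union>d\<in>D. (\<lambda>x. L (d + x)) ` attractor)"
proof (intro subset_antisym subsetI)
  fix x assume "x \<in> attractor"
  then obtain d where d: "\<And>i. d i \<in> D" and s: "(\<lambda>i. (L ^^ Suc i) (d i)) sums x"
    unfolding attractor_def by blast
  define t where "t = (\<Sum>i. (L ^^ Suc i) (d (Suc i)))"
  have t: "(\<lambda>i. (L ^^ Suc i) (d (Suc i))) sums t"
    unfolding t_def by (intro summable_sums digit_summable d)
  then have "x = L (d 0 + t)"
    using s sums_prepend sums_unique2 by blast
  moreover have "t \<in> attractor" unfolding attractor_def mem_Collect_eq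
    by (rule exI[of _ "\<lambda>i. d (Suc i)"]) (use d t in simp)
  ultimately show "x \<in> (\<Union>d\<in>D. (\<lambda>x. L (d + x)) ` attractor)" using d by blast
next
  fix x assume "x \<in> (\<Union>d\<in>D. (\<lambda>x. L (d + x)) ` attractor)"
  then obtain c t d where "c \<in> D" and x: "x = L (c + t)" and d: "\<And>i. d i \<in> D"
    and t: "(\<lambda>i. (L ^^ Suc i) (d i)) sums t"
    unfolding attractor_def by blast
  have "(\<lambda>i. (L ^^ Suc i) (case_nat c d i)) sums L (case_nat c d 0 + t)"
    by (rule sums_prepend) (use t in simp)
  moreover have "case_nat c d i \<in> D" for i
    using d \<open>c \<in> D\<close> by (simp split: nat.split)
  ultimately show "x \<in> attractor" unfolding attractor_def x mem_Collect_eq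
    by (intro exI[of _ "case_nat c d"]) simp
qed

lemma L_in_attractor: "d \<in> D \<Longrightarrow> t \<in> attractor \<Longrightarrow> L (d + t) \<in> attractor"
  using attractor_unfold by blast

section \<open>The difference set T - T\<close>

lemma uminus_in_differences: "w \<in> differences \<Longrightarrow> - w \<in> differences"
  unfolding differences_def by force

lemma zero_in_differences: "0 \<in> differences"
  unfolding differences_def using attractor_nonempty by force

lemma differences_bounded: obtains R where "\<And>w. w \<in> differences \<Longrightarrow> norm w \<le> R"
proof -
  obtain R where R: "\<And>t. t \<in> attractor \<Longrightarrow> norm t \<le> R" using attractor_bounded by blast
  have "norm w \<le> R + R" if w: "w \<in> differences" for w
  proof -
    obtain s t where "s \<in> attractor" "t \<in> attractor" "w = s - t"
      using w unfolding differences_def by blast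
    then show ?thesis
      unfolding \<open>w = s - t\<close>
      using norm_triangle_ineq4[of s t] R[OF \<open>s \<in> attractor\<close>] R[OF \<open>t \<in> attractor\<close>] by linarith
  qed
  then show thesis using that by blast
qed

lemma differences_step:
  assumes "w \<in> differences" and AL: "\<And>x. A (L x) = x" and "linear A"
  shows "\<exists>d\<in>D. \<exists>d'\<in>D. A w - (d - d') \<in> differences"
proof -
  obtain s t where st: "s \<in> attractor" "t \<in> attractor" "w = s - t" using assms(1) differences_def by blast
  then obtain d d' s' t' where "d \<in> D" "d' \<in> D" "s' \<in> attractor" "t' \<in> attractor"
    and s: "s = L (d + s')" and t: "t = L (d' + t')"
    using attractor_unfold by blast
  moreover have "A w = (d + s') - (d' + t')"
    using AL by (simp add: st(3) linear_diff[OF \<open>linear A\<close>] s t)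
  then have "A w - (d - d') = s' - t'" by simp
  ultimately show ?thesis unfolding differences_def by blast
qed

text \<open>Iterated successors give two digit sequences whose partial sums differ by
  \<open>w - (L ^^ n) (W n)\<close>; the remainder tends to 0 because \<open>S\<close> is
  bounded.\<close>

lemma differences_greatest:
  assumes "bounded S" and "w \<in> S" and LA: "\<And>x. L (A x) = x"
    and step: "\<And>w. w \<in> S \<Longrightarrow> \<exists>d\<in>D. \<exists>d'\<in>D. A w - (d - d') \<in> S"
  shows "w \<in> differences"
proof -
  obtain f g where fg: "\<And>w. w \<in> S \<Longrightarrow> f w \<in> D \<and> g w \<in> D \<and> A w - (f w - g w) \<in> S"
    using step by metis
  define W where "W n = ((\<lambda>w. A w - (f w - g w)) ^^ n) w" for n
  have WS: "W n \<in> S" for n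
    by (induction n) (auto simp: W_def \<open>w \<in> S\<close> fg)
  have sf: "summable (\<lambda>i. (L ^^ Suc i) (f (W i)))" and sg: "summable (\<lambda>i. (L ^^ Suc i) (g (W i)))"
    by (rule digit_summable, use fg WS in blast)+
  have partial: "(\<Sum>i<n. (L ^^ Suc i) (f (W i))) - (\<Sum>i<n. (L ^^ Suc i) (g (W i)))
      = w - (L ^^ n) (W n)" for n
  proof (induction n)
    case 0
    then show ?case by (simp add: W_def)
  next
    case (Suc n)
    have lin: "linear (L ^^ Suc n)" by (rule linear_funpow[OF linear_L])
    have "(L ^^ Suc n) (W (Suc n)) = (L ^^ Suc n) (A (W n) - (f (W n) - g (W n)))"
      by (simp add: W_def)
    also have "\<dots> = (L ^^ Suc n) (A (W n)) - ((L ^^ Suc n) (f (W n)) - (L ^^ Suc n) (g (W n)))"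
      by (simp only: linear_diff[OF lin])
    also have "(L ^^ Suc n) (A (W n)) = (L ^^ n) (W n)"
      by (simp add: funpow_Suc_right LA del: funpow.simps)
    finally have X: "(L ^^ Suc n) (W (Suc n)) =
        (L ^^ n) (W n) - ((L ^^ Suc n) (f (W n)) - (L ^^ Suc n) (g (W n)))" .
    have "(\<Sum>i<Suc n. (L ^^ Suc i) (f (W i))) - (\<Sum>i<Suc n. (L ^^ Suc i) (g (W i)))
        = (\<Sum>i<n. (L ^^ Suc i) (f (W i))) - (\<Sum>i<n. (L ^^ Suc i) (g (W i)))
          + ((L ^^ Suc n) (f (W n)) - (L ^^ Suc n) (g (W n)))"
      by (simp del: funpow.simps)
    then show ?case
      unfolding Suc.IH X by simp
  qed
  obtain B where B: "\<And>w. w \<in> S \<Longrightarrow> norm w \<le> B" using \<open>bounded S\<close> bounded_iff by metis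
  have "(\<lambda>n. e n * B) \<longlonglongrightarrow> 0"
    using tendsto_mult_left_zero[OF summable_LIMSEQ_zero[OF summable_e]] by simp
  then have "(\<lambda>n. (L ^^ n) (W n)) \<longlonglongrightarrow> 0"
    by (rule Lim_null_comparison[rotated])
      (auto intro!: always_eventually order_trans[OF norm_pow] mult_left_mono B WS e_nonneg)
  then have "(\<lambda>n. w - (L ^^ n) (W n)) \<longlonglongrightarrow> w"
    using tendsto_diff[OF tendsto_const[of w]] by fastforce
  moreover have "(\<lambda>n. w - (L ^^ n) (W n)) \<longlonglongrightarrow>
      (\<Sum>i. (L ^^ Suc i) (f (W i))) - (\<Sum>i. (L ^^ Suc i) (g (W i)))"
    unfolding partial[symmetric] by (intro tendsto_diff summable_LIMSEQ sf sg)
  ultimately have "w = (\<Sum>i. (L ^^ Suc i) (f (W i))) - (\<Sum>i. (L ^^ Suc i) (g (W i)))"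
    by (rule LIMSEQ_unique)
  moreover have "(\<Sum>i. (L ^^ Suc i) (f (W i))) \<in> attractor" "(\<Sum>i. (L ^^ Suc i) (g (W i))) \<in> attractor"
    by (rule suminf_in_attractor, use fg WS in blast)+
  ultimately show ?thesis unfolding differences_def by blast
qed

text \<open>The iterates of a large ball under the function system are connected, contain the attractor and
  converge to it, so a separation of the attractor would separate one of them.\<close>

lemma connected_if_star:
  assumes "c \<in> D" and star: "\<And>d. d \<in> D \<Longrightarrow> d - c \<in> differences"
  shows "connected attractor"
proof (rule ccontr)
  assume "\<not> connected attractor"
  then obtain P Q where PQ: "closed P" "closed Q" "P \<noteq> {}" "Q \<noteq> {}" "P \<union> Q = attractor" "P \<inter> Q = {}"
    using connected_closed_set[OF compact_imp_closed[OF attractor_compact]] by auto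
  have "compact P"
    using PQ compact_Int_closed[OF attractor_compact, of P] by (metis Int_Un_distrib2 Int_absorb Un_Int_eq(1))
  then obtain U V where UV: "open U" "open V" "P \<subseteq> U" "Q \<subseteq> V" "U \<inter> V = {}"
    using separation_normal_compact[of P Q] PQ by metis
  then have "attractor \<subseteq> U \<union> V" "open (U \<union> V)" using PQ by auto
  then obtain \<epsilon> where "\<epsilon> > 0" and \<epsilon>: "(\<Union>x\<in>attractor. ball x \<epsilon>) \<subseteq> U \<union> V"
    using compact_subset_open_imp_ball_epsilon_subset[OF attractor_compact] by metis
  obtain R where R: "\<And>t. t \<in> attractor \<Longrightarrow> norm t \<le> R" using attractor_bounded by blast
  \<comment> \<open>The ball contains the attractor, which is fixed by the system, so every iterate
    contains it too.\<close>
  define S where "S n = ((\<lambda>S. \<Union>d\<in>D. (\<lambda>x. L (d + x)) ` S) ^^ n) (cball 0 R)" for n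
  have S_Suc: "S (Suc n) = (\<Union>d\<in>D. (\<lambda>x. L (d + x)) ` S n)" for n
    by (simp add: S_def)
  have attractor_S: "attractor \<subseteq> S n" for n
  proof (induction n)
    case 0
    then show ?case using R by (auto simp: S_def)
  next
    case (Suc n)
    then show ?case unfolding S_Suc by (subst attractor_unfold) blast
  qed
  have con: "connected (S n)" for n
  proof (induction n)
    case 0
    then show ?case by (simp add: S_def)
  next
    case (Suc n)
    let ?f = "\<lambda>d. (\<lambda>x. L (d + x)) ` S n"
    have con_f: "connected (?f d)" for d
      by (intro connected_continuous_image continuous_on_piece Suc)
    have meet: "?f c \<inter> ?f d \<noteq> {}" if "d \<in> D" for d
    proof -
      obtain s t where "s \<in> attractor" "t \<in> attractor" "d - c = s - t"
        using star[OF \<open>d \<in> D\<close>] differences_def by blast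
      then have "d + t = c + s" "s \<in> S n" "t \<in> S n"
        using attractor_S by (auto simp: algebra_simps)
      then have "L (c + s) = L (d + t)" by simp
      with \<open>s \<in> S n\<close> \<open>t \<in> S n\<close> show ?thesis by blast
    qed
    have "connected (\<Union>d\<in>D. ?f c \<union> ?f d)"
    proof (rule connected_Union)
      show "connected X" if "X \<in> (\<lambda>d. ?f c \<union> ?f d) ` D" for X
        using that con_f meet by (auto intro!: connected_Un)
      have "?f c \<subseteq> \<Inter>((\<lambda>d. ?f c \<union> ?f d) ` D)" by blast
      moreover have "?f c \<noteq> {}" using meet[OF \<open>c \<in> D\<close>] by blast
      ultimately show "\<Inter>((\<lambda>d. ?f c \<union> ?f d) ` D) \<noteq> {}" by blast
    qed
    moreover have "(\<Union>d\<in>D. ?f c \<union> ?f d) = S (Suc n)"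
      unfolding S_Suc using \<open>c \<in> D\<close> by blast
    ultimately show ?case by simp
  qed
  \<comment> \<open>\<open>t\<close> is built with the same \<open>n\<close> leading digits as
    \<open>x\<close>; they cancel in the difference.\<close>
  have near: "\<exists>t\<in>attractor. \<exists>y z. norm y \<le> R \<and> norm z \<le> R \<and> x - t = (L ^^ n) (y - z)"
    if "x \<in> S n" for n x
    using that
  proof (induction n arbitrary: x)
    case 0
    moreover obtain t where "t \<in> attractor" using attractor_nonempty by blast
    ultimately show ?case using R by (auto simp: S_def)
  next
    case (Suc n)
    then obtain d x' where "d \<in> D" "x' \<in> S n" and x: "x = L (d + x')" unfolding S_Suc by blast
    then obtain t y z where *: "t \<in> attractor" "norm y \<le> R" "norm z \<le> R" "x' - t = (L ^^ n) (y - z)"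
      using Suc.IH by blast
    have "x - L (d + t) = L (x' - t)"
      using linear_diff[OF linear_L, of "d + x'" "d + t"] by (simp add: x)
    with * show ?case
      using L_in_attractor[OF \<open>d \<in> D\<close> \<open>t \<in> attractor\<close>] by (intro bexI[of _ "L (d + t)"] exI[of _ y] exI[of _ z]) auto
  qed
  have "(\<lambda>n. e n * (R + R)) \<longlonglongrightarrow> 0"
    using tendsto_mult_left_zero[OF summable_LIMSEQ_zero[OF summable_e]] by simp
  then obtain n where n: "e n * (R + R) < \<epsilon>"
    using \<open>\<epsilon> > 0\<close> by (metis eventually_sequentially order_refl order_tendstoD(2))
  have "S n \<subseteq> U \<union> V"
  proof
    fix x assume "x \<in> S n"
    then obtain t y z where *: "t \<in> attractor" "norm y \<le> R" "norm z \<le> R" "x - t = (L ^^ n) (y - z)"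
      using near by blast
    have "norm (x - t) \<le> e n * norm (y - z)"
      unfolding * by (rule norm_pow)
    also have "\<dots> \<le> e n * (R + R)"
      using * norm_triangle_ineq4[of y z] by (intro mult_left_mono e_nonneg) linarith
    finally have "x \<in> ball t \<epsilon>" using n by (simp add: dist_norm norm_minus_commute)
    then show "x \<in> U \<union> V" using \<epsilon> \<open>t \<in> attractor\<close> by blast
  qed
  moreover have "U \<inter> S n \<noteq> {}"
    using PQ(3,5) UV(3) attractor_S[of n] by blast
  moreover have "V \<inter> S n \<noteq> {}"
    using PQ(4,5) UV(4) attractor_S[of n] by blast
  ultimately show False
    using connectedD[OF con[of n] UV(1,2)] UV(5) by blast
qed

text \<open>A common point of the pieces of \<open>c\<close> and \<open>d\<close> would, by
  injectivity of \<open>L\<close>, put \<open>c - d\<close> into \<open>differences\<close>. So the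
  piece of \<open>c\<close> and the union of the others separate the attractor.\<close>

lemma not_connected_if_isolated:
  assumes "c \<in> D" and "D \<noteq> {c}" and "inj L" and iso: "\<And>d. d \<in> D \<Longrightarrow> d \<noteq> c \<Longrightarrow> c - d \<notin> differences"
  shows "\<not> connected attractor"
proof -
  let ?f = "\<lambda>d. (\<lambda>x. L (d + x)) ` attractor"
  have cl: "closed (?f d)" for d
    by (intro compact_imp_closed compact_continuous_image continuous_on_piece attractor_compact)
  have disj: "?f c \<inter> ?f d = {}" if "d \<in> D" "d \<noteq> c" for d
  proof (rule ccontr)
    assume "?f c \<inter> ?f d \<noteq> {}"
    then obtain s t where *: "s \<in> attractor" "t \<in> attractor" "L (c + s) = L (d + t)" by blast
    have "c + s = d + t" by (rule injD[OF \<open>inj L\<close> *(3)])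
    then have "c - d = t - s" by (simp add: algebra_simps)
    then show False using iso[OF that] *(1,2) unfolding differences_def by blast
  qed
  let ?Q = "\<Union>d\<in>D - {c}. ?f d"
  have "closed ?Q" using finite_D cl by (intro closed_UN) auto
  moreover have "?f c \<union> ?Q = attractor"
    by (rule trans[OF _ attractor_unfold[symmetric]]) (use \<open>c \<in> D\<close> in blast)
  moreover have "?f c \<inter> ?Q = {}" using disj by blast
  moreover have "?f c \<noteq> {}" using attractor_nonempty by blast
  moreover have "?Q \<noteq> {}" using attractor_nonempty assms(1,2) by blast
  ultimately show ?thesis
    unfolding connected_closed_set[OF compact_imp_closed[OF attractor_compact]] not_not
    by (intro exI[of _ "?f c"] exI[of _ ?Q] conjI cl)
qed

end

subsection \<open>Integer orbits\<close>

text \<open>A pair \<open>(x, y)\<close> stands for the vector \<open>x v + y A v\<close>, except that the digit difference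
  \<open>(a, b)\<close> stands for \<open>a v + b k A v\<close>. When \<open>A\<close> has characteristic polynomial
  \<open>t\<^sup>2 + p t + q\<close>, it maps \<open>(x, y)\<close> to \<open>(- q y, x - p y)\<close>.\<close>

definition digit_differences :: "(int \<times> int) set" where
  "digit_differences = {(0,0), (1,0), (-1,0), (0,1), (0,-1), (1,-1), (-1,1)}"

definition admissible :: "int \<Rightarrow> int \<Rightarrow> bool" where
  "admissible p q \<longleftrightarrow> (q = 3 \<and> \<bar>p\<bar> \<le> 3) \<or> (q = -3 \<and> \<bar>p\<bar> \<le> 1)"

text \<open>The image of a finite set of this kind in the plane lies in T - T by
  \<open>differences_greatest\<close>.\<close>

definition self_covering :: "int \<Rightarrow> int \<Rightarrow> int \<Rightarrow> (int \<times> int) set \<Rightarrow> bool" where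
  "self_covering p q k S \<longleftrightarrow>
     (\<forall>(x, y)\<in>S. \<exists>(a, b)\<in>digit_differences. (- q * y - a, x - p * y - k * b) \<in> S)"

lemma admissible_cases:
  assumes "admissible p q"
  obtains "q = 3" "p = 0" | "q = 3" "p = 1" | "q = 3" "p = -1" | "q = 3" "p = 2" | "q = 3" "p = -2"
    | "q = 3" "p = 3" | "q = 3" "p = -3" | "q = -3" "p = 0" | "q = -3" "p = 1" | "q = -3" "p = -1"
proof -
  have "p = 0 \<or> p = 1 \<or> p = -1 \<or> p = 2 \<or> p = -2 \<or> p = 3 \<or> p = -3" if "\<bar>p\<bar> \<le> 3"
    using that by arith
  then show ?thesis using assms that unfolding admissible_def by (elim disjE conjE) auto
qed

text \<open>Each witness consists, up to sign, of orbits that run into a cycle.\<close>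

lemma self_covering_witnesses:
  "\<forall>(p, q)\<in>set [(0, 3), (1, 3), (-1, 3), (2, 3), (-2, 3), (3, 3), (-3, 3), (0, -3), (1, -3), (-1, -3)].
    \<forall>k\<in>set [1, -1]. \<exists>xs\<in>set [[(1, -1), (1, 0), (2, -1)], [(0, 1), (1, 0), (4, -2), (5, -2)],
        [(0, 1), (1, 0), (2, -1), (2, 0)], [(0, 1), (1, 0), (2, 0), (3, -1)],
        [(0, 1), (1, 0), (2, 0)], [(0, 1), (1, 0), (2, 0), (2, 1)],
        [(0, 1), (1, 0), (2, 0), (3, 1)], [(0, 1), (1, 0), (4, 2), (5, 2)],
        [(1, 0), (1, 1), (3, 1)], [(1, -1), (1, 0), (3, -1)], [(1, 0), (1, 1), (2, 1)]].
      self_covering p q k (set xs \<union> uminus ` set xs) \<and> (1, 0) \<in> set xs \<and>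
      ((0, k) \<in> set xs \<union> uminus ` set xs \<or> (-1, k) \<in> set xs \<union> uminus ` set xs)"
  by code_simp

text \<open>\<open>(1, 0)\<close> makes the pieces of \<open>0\<close> and \<open>v\<close> meet;
  \<open>(0, k)\<close> joins the third piece to that of \<open>0\<close>, \<open>(-1, k)\<close> to
  that of \<open>v\<close>.\<close>

lemma self_covering_exists:
  assumes "admissible p q" and "k = 1 \<or> k = -1"
  shows "\<exists>S. finite S \<and> self_covering p q k S \<and> (1, 0) \<in> S \<and> ((0, k) \<in> S \<or> (-1, k) \<in> S)"
proof -
  have pq: "(p, q) \<in> set [(0, 3), (1, 3), (-1, 3), (2, 3), (-2, 3), (3, 3), (-3, 3),
      (0, -3), (1, -3), (-1, -3)]"
    using assms(1) by (cases rule: admissible_cases) simp_all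
  have k: "k \<in> set [1, -1]" using assms(2) by auto
  obtain xs where "self_covering p q k (set xs \<union> uminus ` set xs)" "(1, 0) \<in> set xs"
    "(0, k) \<in> set xs \<union> uminus ` set xs \<or> (-1, k) \<in> set xs \<union> uminus ` set xs"
    using bspec[OF self_covering_witnesses pq, unfolded case_prod_conv, THEN bspec, OF k] by blast
  then show ?thesis
    by (intro exI[of _ "set xs \<union> uminus ` set xs"]) blast
qed

text \<open>A search tree over all digit choices: on each branch the second coordinate exceeds
  \<open>M\<close> within \<open>n\<close> steps.\<close>

fun escapes :: "int \<Rightarrow> int \<Rightarrow> int \<Rightarrow> int \<Rightarrow> nat \<Rightarrow> int \<Rightarrow> int \<Rightarrow> bool" where
  "escapes p q k M 0 x y \<longleftrightarrow> \<bar>y\<bar> > M"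
| "escapes p q k M (Suc n) x y \<longleftrightarrow> \<bar>y\<bar> > M \<or>
     (\<forall>(a, b)\<in>digit_differences. escapes p q k M n (- q * y - a) (x - p * y - k * b))"

text \<open>Integrality ensures that the largest modulus is attained; the recurrence is then
  evaluated there.\<close>

lemma bounded_int_attains_max:
  fixes y :: "nat \<Rightarrow> int"
  assumes "\<And>n. \<bar>y n\<bar> \<le> B"
  obtains N where "\<And>n. \<bar>y n\<bar> \<le> \<bar>y N\<bar>"
proof -
  have "finite (range (\<lambda>n. \<bar>y n\<bar>))"
    by (rule finite_subset[of _ "{0..B}"]) (use assms in auto)
  then have "Max (range (\<lambda>n. \<bar>y n\<bar>)) \<in> range (\<lambda>n. \<bar>y n\<bar>)" "\<And>n. \<bar>y n\<bar> \<le> Max (range (\<lambda>n. \<bar>y n\<bar>))"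
    by (auto intro!: Max_in Max_ge)
  then show thesis using that by (metis imageE)
qed

lemma escapes_sound:
  assumes step: "\<And>n. \<exists>(a, b)\<in>digit_differences.
      x (Suc n) = - q * y n - a \<and> y (Suc n) = x n - p * y n - k * b"
    and "escapes p q k M m (x n) (y n)"
  shows "\<exists>j. \<bar>y j\<bar> > M"
  using assms(2)
proof (induction m arbitrary: n)
  case (Suc m)
  obtain a b where "(a, b) \<in> digit_differences"
    "x (Suc n) = - q * y n - a" "y (Suc n) = x n - p * y n - k * b"
    using step by blast
  then have "\<bar>y n\<bar> > M \<or> escapes p q k M m (x (Suc n)) (y (Suc n))"
    using Suc.prems by auto
  then show ?case using Suc.IH by blast
qed auto

text \<open>The thresholds are the integer parts of the bounds on |y N| found in
  \<open>no_bounded_orbit\<close>.\<close>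

lemma escapes_small:
  "\<forall>k\<in>{-5, -4, -3, -2, 2, 3, 4, 5}. \<forall>x\<in>{0, -1}.
    escapes 1 3 k (2 * (\<bar>k\<bar> + 1) div 3) 3 x k \<and>
    escapes (-1) 3 k (2 * (\<bar>k\<bar> + 1) div 3) 3 x k \<and>
    escapes 2 3 k (5 * (\<bar>k\<bar> + 1) div 6) 4 x k \<and>
    escapes (-2) 3 k (5 * (\<bar>k\<bar> + 1) div 6) 4 x k \<and>
    escapes 3 3 k (7 * (\<bar>k\<bar> + 1) div 5) 6 x k \<and>
    escapes (-3) 3 k (7 * (\<bar>k\<bar> + 1) div 5) 6 x k \<and>
    escapes 1 (-3) k (\<bar>k\<bar> + 1) 4 x k \<and>
    escapes (-1) (-3) k (\<bar>k\<bar> + 1) 4 x k"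
  by code_simp

lemma no_bounded_orbit:
  assumes "admissible p q" and k: "\<bar>k\<bar> \<ge> 2"
    and x0: "x 0 = 0 \<or> x 0 = -1" and y0: "y 0 = k"
    and step: "\<And>n. \<exists>(a, b)\<in>digit_differences.
      x (Suc n) = - q * y n - a \<and> y (Suc n) = x n - p * y n - k * b"
    and bound: "\<And>n. \<bar>y n\<bar> \<le> B"
  shows False
proof -
  obtain a b where ab: "\<And>n. (a n, b n) \<in> digit_differences"
    and xs: "\<And>n. x (Suc n) = - q * y n - a n" and ys: "\<And>n. y (Suc n) = x n - p * y n - k * b n"
    using step unfolding Bex_def split_paired_Ex case_prod_conv by metis
  have a: "\<bar>a n\<bar> \<le> 1" for n
    using ab[of n] by (auto simp: digit_differences_def)
  have kb: "k * b n = k \<or> k * b n = 0 \<or> k * b n = - k" for n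
    using ab[of n] by (auto simp: digit_differences_def)
  \<comment> \<open>Eliminating \<open>x\<close> leaves a second-order recurrence for
    \<open>y\<close> with bounded forcing term \<open>c\<close>.\<close>
  define c where "c n = y (n + 2) + p * y (n + 1) + q * y n" for n
  have "c n = - a n - k * b (n + 1)" for n
    unfolding c_def using xs[of n] ys[of "n + 1"] by simp
  then have c: "\<bar>c n\<bar> \<le> \<bar>k\<bar> + 1" for n
    using a[of n] kb[of "n + 1"] by (smt (verit))
  obtain N where N: "\<And>n. \<bar>y n\<bar> \<le> \<bar>y N\<bar>"
    using bounded_int_attains_max[of y B] bound by blast
  note maxs = N[of 0] N[of 1] N[of 2] N[of "N + 1"] N[of "N + 2"] N[of "N + 3"] N[of "N + 4"]
  have shift: "y (N + 1 + 2) = y (N + 3)" "y (N + 1 + 1) = y (N + 2)" "y (N + 2 + 1) = y (N + 3)"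
    "y (N + 2 + 2) = y (N + 4)" by (simp_all add: numeral_eq_Suc)
  have small: "\<bar>y N\<bar> > M" if "escapes p q k M m (x 0) k" for M m
    using escapes_sound[of x q y p k M m 0, OF step] that N y0 by (metis order_less_le_trans)
  note cs = c[of N, unfolded c_def] c[of "N + 1", unfolded c_def shift] c[of "N + 2", unfolded c_def shift]
  have y1: "y 1 = x 0 - p * k - k * b 0" and x1: "x 1 = - q * k - a 0"
    using ys[of 0] xs[of 0] y0 by simp_all
  have y2: "y 2 = - q * k - a 0 - p * y 1 - k * b 1"
    using ys[of 1] x1 by (simp add: numeral_2_eq_2)
  \<comment> \<open>The 5 comes from \<open>p = 2\<close> and \<open>p = -2\<close>, where the bound
    on the maximum gives 6|k| \<le> 5(|k| + 1) at the start; the other cases force smaller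
    |k|.\<close>
  have range: "k \<in> {-5, -4, -3, -2, 2, 3, 4, 5}" if "\<bar>k\<bar> \<le> 5"
    using that k by auto
  have "x 0 \<in> {0, -1}" using x0 by simp
  note esc = escapes_small[THEN bspec, OF range, THEN bspec, OF _ this]
  \<comment> \<open>Multiplying \<open>t\<^sup>2 + p t + q\<close> by \<open>1\<close>, \<open>t \<mp> 3\<close>, \<open>2 t \<mp> 3\<close> or \<open>t\<^sup>2 \<mp> 3 t + 3\<close> gives a polynomial
    with dominating constant coefficient, hence a bound on the maximum \<open>\<bar>y N\<bar>\<close> in terms of \<open>\<bar>k\<bar> + 1\<close>.\<close>
  show False
    using assms(1)
  proof (cases rule: admissible_cases)
    case 1
    \<comment> \<open>With \<open>p = 0\<close> the recurrence gives 2|y N| \<le> |k| + 1, whereas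
      |y N| \<ge> |y 0| = |k| \<ge> 2.\<close>
    show False using cs(1) maxs(1,5) y0 k unfolding 1 by (smt (verit))
  next
    case 2
    have *: "3 * \<bar>y N\<bar> \<le> 2 * (\<bar>k\<bar> + 1)"
      using cs(1,2) maxs unfolding 2 by (smt (verit))
    have k5: "\<bar>k\<bar> \<le> 5" using * maxs(1) y0 by (smt (verit))
    have "escapes p q k (2 * (\<bar>k\<bar> + 1) div 3) 3 (x 0) k"
      using esc[OF k5] unfolding 2 by blast
    from small[OF this] show False using * by linarith
  next
    case 3
    have *: "3 * \<bar>y N\<bar> \<le> 2 * (\<bar>k\<bar> + 1)"
      using cs(1,2) maxs unfolding 3 by (smt (verit))
    have k5: "\<bar>k\<bar> \<le> 5" using * maxs(1) y0 by (smt (verit))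
    have "escapes p q k (2 * (\<bar>k\<bar> + 1) div 3) 3 (x 0) k"
      using esc[OF k5] unfolding 3 by blast
    from small[OF this] show False using * by linarith
  next
    case 4
    have *: "6 * \<bar>y N\<bar> \<le> 5 * (\<bar>k\<bar> + 1)"
      using cs(1,2) maxs unfolding 4 by (smt (verit))
    have k5: "\<bar>k\<bar> \<le> 5" using * maxs(1) y0 by (smt (verit))
    have "escapes p q k (5 * (\<bar>k\<bar> + 1) div 6) 4 (x 0) k"
      using esc[OF k5] unfolding 4 by blast
    from small[OF this] show False using * by linarith
  next
    case 5
    have *: "6 * \<bar>y N\<bar> \<le> 5 * (\<bar>k\<bar> + 1)"
      using cs(1,2) maxs unfolding 5 by (smt (verit))
    have k5: "\<bar>k\<bar> \<le> 5" using * maxs(1) y0 by (smt (verit))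
    have "escapes p q k (5 * (\<bar>k\<bar> + 1) div 6) 4 (x 0) k"
      using esc[OF k5] unfolding 5 by blast
    from small[OF this] show False using * by linarith
  next
    case 6
    have *: "5 * \<bar>y N\<bar> \<le> 7 * (\<bar>k\<bar> + 1)"
      using cs maxs unfolding 6 by (smt (verit))
    \<comment> \<open>The start gives only 5|k| \<le> 7(|k| + 1), which is vacuous; the next term
      satisfies |y 1| \<ge> 2|k| - 1 and yields |k| \<le> 4.\<close>
    have k5: "\<bar>k\<bar> \<le> 5" using * maxs(2) y1 x0 kb[of 0] unfolding 6 by (smt (verit))
    have "escapes p q k (7 * (\<bar>k\<bar> + 1) div 5) 6 (x 0) k"
      using esc[OF k5] unfolding 6 by blast
    from small[OF this] show False using * by linarith
  next
    case 7
    have *: "5 * \<bar>y N\<bar> \<le> 7 * (\<bar>k\<bar> + 1)"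
      using cs maxs unfolding 7 by (smt (verit))
    have k5: "\<bar>k\<bar> \<le> 5" using * maxs(2) y1 x0 kb[of 0] unfolding 7 by (smt (verit))
    have "escapes p q k (7 * (\<bar>k\<bar> + 1) div 5) 6 (x 0) k"
      using esc[OF k5] unfolding 7 by blast
    from small[OF this] show False using * by linarith
  next
    case 8
    show False using cs(1) maxs(1,5) y0 k unfolding 8 by (smt (verit))
  next
    case 9
    have *: "\<bar>y N\<bar> \<le> \<bar>k\<bar> + 1"
      using cs(1) maxs unfolding 9 by (smt (verit))
    \<comment> \<open>The start is again uninformative, but either |y 1| \<ge> 2|k| - 1 or |y 2|
      \<ge> 2|k| - 2, depending on the first digit difference.\<close>
    have k5: "\<bar>k\<bar> \<le> 5"
    proof -
      have "y 1 = x 0 - k - k * b 0" "y 2 = 3 * k - a 0 - y 1 - k * b 1"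
        using y1 y2 unfolding 9 by simp_all
      then show ?thesis
        using * maxs(1,2,3) y0 x0 a[of 0] kb[of 0] kb[of 1] by (smt (verit))
    qed
    have "escapes p q k (\<bar>k\<bar> + 1) 4 (x 0) k"
      using esc[OF k5] unfolding 9 by blast
    from small[OF this] show False using * by linarith
  next
    case 10
    have *: "\<bar>y N\<bar> \<le> \<bar>k\<bar> + 1"
      using cs(1) maxs unfolding 10 by (smt (verit))
    have k5: "\<bar>k\<bar> \<le> 5"
    proof -
      have "y 1 = x 0 + k - k * b 0" "y 2 = 3 * k - a 0 + y 1 - k * b 1"
        using y1 y2 unfolding 10 by simp_all
      then show ?thesis
        using * maxs(1,2,3) y0 x0 a[of 0] kb[of 0] kb[of 1] by (smt (verit))
    qed
    have "escapes p q k (\<bar>k\<bar> + 1) 4 (x 0) k"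
      using esc[OF k5] unfolding 10 by blast
    from small[OF this] show False using * by linarith
  qed
qed

subsection \<open>Expanding plane matrices of determinant \<open>\<plusminus>3\<close>\<close>

text \<open>Summing the recurrence bounds 9 times a partial sum, up to its first four terms, by 7 +
  1 = 8 times the same sum; the gap leaves a uniform bound.\<close>

lemma summable_two_step_recurrence:
  fixes a :: "nat \<Rightarrow> real"
  assumes nonneg: "\<And>n. a n \<ge> 0" and rec: "\<And>n. 9 * a (n + 4) \<le> 7 * a (n + 2) + a n"
  shows "summable a"
proof (rule summableI_nonneg_bounded[OF nonneg])
  fix n
  define S where "S N = (\<Sum>i<N. a i)" for N
  have mono: "S M \<le> S N" if "M \<le> N" for M N
    unfolding S_def using that nonneg by (intro sum_mono2) auto
  have shift: "(\<Sum>i<N. a (i + j)) = S (N + j) - S j" for N j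
  proof -
    have "S (N + j) = S j + (\<Sum>i\<in>{j..<N + j}. a i)"
      unfolding S_def by (metis atLeast0LessThan le_add2 sum.atLeastLessThan_concat zero_le)
    also have "(\<Sum>i\<in>{j..<N + j}. a i) = (\<Sum>i<N. a (i + j))"
      using sum.shift_bounds_nat_ivl[of a 0 j N] by (simp add: atLeast0LessThan)
    finally show ?thesis by simp
  qed
  have "9 * (S (n + 4) - S 4) = (\<Sum>i<n. 9 * a (i + 4))"
    by (simp add: sum_distrib_left[symmetric] shift)
  also have "\<dots> \<le> (\<Sum>i<n. 7 * a (i + 2) + a i)"
    by (intro sum_mono rec)
  also have "\<dots> = 7 * (S (n + 2) - S 2) + S n"
    unfolding sum.distrib sum_distrib_left[symmetric] shift by (simp add: S_def)
  also have "\<dots> \<le> 7 * S (n + 4) + S (n + 4)"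
    using mono[of "n + 2" "n + 4"] mono[of n "n + 4"] mono[of 0 2] by (simp add: S_def)
  finally show "sum a {..<n} \<le> 9 * S 4"
    using mono[of n "n + 4"] by (simp add: S_def)
qed

text \<open>This is \<open>(t\<^sup>2 + p t + q) (t\<^sup>2 - p t + q) = t\<^sup>4 - (p\<^sup>2 - 2 q) t\<^sup>2 + q\<^sup>2\<close>; for every expanding matrix of
  determinant \<open>\<plusminus>3\<close> the coefficients now satisfy \<open>\<bar>p\<^sup>2 - 2 q\<bar> + 1 < q\<^sup>2\<close>, so that inverse orbits are summable.\<close>

lemma every_second_term:
  fixes X :: "nat \<Rightarrow> 'a::real_vector"
  assumes rec: "\<And>n. X n = - (p *\<^sub>R X (Suc n)) - q *\<^sub>R X (Suc (Suc n))"
  shows "q\<^sup>2 *\<^sub>R X (n + 4) = (p\<^sup>2 - 2 * q) *\<^sub>R X (n + 2) - X n"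
proof -
  have X0: "X n = - (p *\<^sub>R X (n + 1)) - q *\<^sub>R X (n + 2)"
    and X3: "q *\<^sub>R X (n + 3) = - (p *\<^sub>R X (n + 2)) - X (n + 1)"
    and X4: "q *\<^sub>R X (n + 4) = - (p *\<^sub>R X (n + 3)) - X (n + 2)"
    using rec[of n] rec[of "n + 1"] rec[of "n + 2"] by (simp_all add: eval_nat_numeral)
  have "q\<^sup>2 *\<^sub>R X (n + 4) = q *\<^sub>R q *\<^sub>R X (n + 4)"
    by (simp add: power2_eq_square)
  also have "\<dots> = - (p *\<^sub>R q *\<^sub>R X (n + 3)) - q *\<^sub>R X (n + 2)"
    by (simp add: X4 scaleR_diff_right mult.commute)
  also have "\<dots> = (p\<^sup>2 - 2 * q) *\<^sub>R X (n + 2) - X n"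
    unfolding X3 X0 by (simp add: power2_eq_square algebra_simps flip: scaleR_2)
  finally show ?thesis .
qed

text \<open>Cayley-Hamilton for plane matrices, evaluated at a vector.\<close>

lemma charpoly_apply:
  fixes A :: "real^2^2"
  shows "A *v (A *v x) = (A$1$1 + A$2$2) *\<^sub>R (A *v x) - det A *\<^sub>R x"
  by (simp add: vec_eq_iff forall_2 matrix_vector_mult_def sum_2 det_2 algebra_simps)

lemma expanding_no_small_real_root:
  fixes A :: "real^2^2"
  assumes "expanding A" and "\<bar>t\<bar> \<le> 1"
  shows "t\<^sup>2 - (A$1$1 + A$2$2) * t + det A \<noteq> 0"
proof
  assume *: "t\<^sup>2 - (A$1$1 + A$2$2) * t + det A = 0"
  have "det (\<chi> i j. complex_of_real (A$i$j) - (if i = j then complex_of_real t else 0))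
      = complex_of_real (t\<^sup>2 - (A$1$1 + A$2$2) * t + det A)"
    by (simp add: det_2 power2_eq_square algebra_simps)
  with * have "cmod (complex_of_real t) > 1"
    using assms(1) unfolding expanding_def by fastforce
  with assms(2) show False by simp
qed

text \<open>The characteristic polynomial has no zero on [-1, 1], so its values at 1 and -1 share
  the sign of its value \<open>det A\<close> at 0. As the trace is an integer, these strict
  inequalities bound its modulus by 3 or 1.\<close>

lemma expanding_admissible:
  fixes A :: "real^2^2"
  assumes "int_matrix A" and "expanding A" and "\<bar>det A\<bar> = 3"
  obtains p q where "admissible p q" "A$1$1 + A$2$2 = - of_int p" "det A = of_int q"
proof -
  have "A$1$1 + A$2$2 \<in> \<int>" using assms(1) unfolding int_matrix_def by simp
  then obtain m where m: "A$1$1 + A$2$2 = of_int m" by (elim Ints_cases)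
  define f where "f t = t\<^sup>2 - of_int m * t + det A" for t :: real
  have nz: "f t \<noteq> 0" if "\<bar>t\<bar> \<le> 1" for t
    using expanding_no_small_real_root[OF assms(2) that] by (simp add: f_def m)
  have cont: "continuous_on X f" for X
    unfolding f_def by (intro continuous_intros)
  have const_sign: "f s > 0 \<longleftrightarrow> f 0 > 0" if "s = 1 \<or> s = -1" for s
  proof -
    have "connected (f ` {-1..1})" by (intro connected_continuous_image cont) simp
    moreover have "0 \<notin> f ` {-1..1}" using nz by (auto simp: abs_le_iff)
    moreover have "f s \<in> f ` {-1..1}" "f 0 \<in> f ` {-1..1}" using that by auto
    ultimately have "\<not> (f s \<le> 0 \<and> 0 \<le> f 0)" "\<not> (f 0 \<le> 0 \<and> 0 \<le> f s)"
      using connectedD_interval by blast+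
    then show ?thesis by linarith
  qed
  have f: "f 0 = det A" "f 1 = 1 - of_int m + det A" "f (-1) = 1 + of_int m + det A"
    by (simp_all add: f_def)
  consider "det A = 3" | "det A = -3" using assms(3) by linarith
  then show thesis
  proof cases
    case 1
    then have "f 1 > 0" "f (-1) > 0" using const_sign[of 1] const_sign[of "-1"] f(1) by simp_all
    then have "\<bar>- m\<bar> \<le> 3" using f 1 by linarith
    then show thesis using that[of "- m" 3] m 1 by (simp add: admissible_def)
  next
    case 2
    then have "\<not> f 1 > 0" "\<not> f (-1) > 0" "f 1 \<noteq> 0" "f (-1) \<noteq> 0"
      using const_sign[of 1] const_sign[of "-1"] nz[of 1] nz[of "-1"] f(1) by simp_all
    then have "\<bar>- m\<bar> \<le> 1" using f 2 by linarith
    then show thesis using that[of "- m" "-3"] m 2 by (simp add: admissible_def)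
  qed
qed

text \<open>This determinant is the denominator when Cramer's rule recovers the coordinate y of x v
  + y u. The condition \<open>v \<noteq> u\<close> keeps \<open>{v, u}\<close> from collapsing to
  one vector.\<close>

lemma independent_pair_det:
  fixes v u :: "real^2"
  assumes "v \<noteq> u" and "independent {v, u}"
  shows "v$1 * u$2 - v$2 * u$1 \<noteq> 0"
proof
  assume *: "v$1 * u$2 - v$2 * u$1 = 0"
  have zero: "a = 0 \<and> b = 0" if "a *\<^sub>R v + b *\<^sub>R u = 0" for a b
  proof -
    have *: "(\<Sum>w\<in>{v, u}. (if w = v then a else b) *\<^sub>R w) = 0"
      using that assms(1) by simp
    from independentD[OF assms(2) _ _ *, of v] independentD[OF assms(2) _ _ *, of u]
    show ?thesis using assms(1) by simp
  qed
  have "u$1 *\<^sub>R v + (- v$1) *\<^sub>R u = 0" "u$2 *\<^sub>R v + (- v$2) *\<^sub>R u = 0"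
    using * by (simp_all add: vec_eq_iff forall_2 algebra_simps)
  then have "v$1 = 0" "v$2 = 0" using zero by (metis neg_equal_0_iff_equal)+
  then have "v = 0" by (simp add: vec_eq_iff forall_2)
  then show False using zero[of 1 0] by simp
qed

text \<open>A crude operator norm bound, which reduces summability to the orbits of basis
  vectors.\<close>

lemma norm_linear_le:
  fixes f :: "'a::euclidean_space \<Rightarrow> 'b::real_normed_vector"
  assumes "linear f"
  shows "norm (f x) \<le> (\<Sum>b\<in>Basis. norm (f b)) * norm x"
proof -
  have "f x = f (\<Sum>b\<in>Basis. (x \<bullet> b) *\<^sub>R b)" by (simp add: euclidean_representation)
  also have "\<dots> = (\<Sum>b\<in>Basis. (x \<bullet> b) *\<^sub>R f b)"
    by (simp add: linear_sum[OF assms] linear_scale[OF assms])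
  also have "norm \<dots> \<le> (\<Sum>b\<in>Basis. norm (f b) * norm x)"
    by (rule sum_norm_le) (simp add: Basis_le_norm mult.commute[of "norm (f _)"] mult_right_mono)
  finally show ?thesis by (simp add: sum_distrib_right)
qed

section \<open>The criterion for connectedness\<close>

theorem theorem1p1:
  fixes A :: "real^2^2" and k :: int and v :: "real^2"
  assumes "int_matrix A"
    and "expanding A"
    and "\<bar>det A\<bar> = 3"
    and "k \<noteq> 0"
    and "v \<noteq> A *v v" and "independent {v, A *v v}"
  shows "connected (self_affine_set A {0, v, of_int k *\<^sub>R (A *v v)})
           \<longleftrightarrow> (k = 1 \<or> k = -1)"
proof -
  define u where "u = A *v v"
  define L where "L = (*v) (matrix_inv A)"
  define D where "D = {0, v, of_int k *\<^sub>R u}"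
  define e where "e n = (\<Sum>b\<in>Basis. norm ((L ^^ n) b))" for n
  obtain p q where adm: "admissible p q"
    and tr: "A$1$1 + A$2$2 = - of_int p" and det: "det A = of_int q"
    using expanding_admissible assms(1-3) by blast
  have "invertible A" using assms(3) by (auto simp: invertible_det_nz)
  then have "A ** matrix_inv A = mat 1 \<and> matrix_inv A ** A = mat 1"
    unfolding invertible_def matrix_inv_def by (rule someI_ex)
  then have AL: "A *v L x = x" and LA: "L (A *v x) = x" for x
    by (simp_all add: L_def matrix_vector_mul_assoc)
  have linL: "linear L" by (simp add: L_def)
  have cp: "A *v (A *v x) = - (of_int p *\<^sub>R (A *v x)) - of_int q *\<^sub>R x" for x
    using charpoly_apply[of A x] by (simp add: tr det)
  have "summable (\<lambda>n. norm ((L ^^ n) b))" for b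
  proof (rule summable_two_step_recurrence)
    fix n
    define X where "X j = (L ^^ j) b" for j
    have AX: "A *v X (Suc j) = X j" for j by (simp add: X_def AL)
    have rec: "X j = - (of_int p *\<^sub>R X (Suc j)) - of_int q *\<^sub>R X (Suc (Suc j))" for j
      using cp[of "X (Suc (Suc j))"] by (simp add: AX)
    \<comment> \<open>The value 7 is attained for \<open>q = -3\<close> and \<open>p = 1\<close> or
      \<open>p = -1\<close>.\<close>
    have q: "(of_int q)\<^sup>2 = (9 :: real)" and p: "\<bar>(of_int p)\<^sup>2 - 2 * of_int q\<bar> \<le> (7 :: real)"
      using adm by (cases rule: admissible_cases; simp)+
    have "9 * norm (X (n + 4)) = norm ((of_int q)\<^sup>2 *\<^sub>R X (n + 4))"
      by (simp add: q)
    also have "\<dots> = norm (((of_int p)\<^sup>2 - 2 * of_int q) *\<^sub>R X (n + 2) - X n)"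
      by (simp only: every_second_term[of X "of_int p" "of_int q" n, OF rec])
    also have "\<dots> \<le> \<bar>(of_int p)\<^sup>2 - 2 * of_int q\<bar> * norm (X (n + 2)) + norm (X n)"
      by (rule order_trans[OF norm_triangle_ineq4]) simp
    also have "\<dots> \<le> 7 * norm (X (n + 2)) + norm (X n)"
      by (intro add_right_mono mult_right_mono p) simp
    finally show "9 * norm ((L ^^ (n + 4)) b) \<le> 7 * norm ((L ^^ (n + 2)) b) + norm ((L ^^ n) b)"
      unfolding X_def .
  qed simp
  then have "summable e" unfolding e_def by (intro summable_sum)
  moreover have "norm ((L ^^ n) x) \<le> e n * norm x" for n x
    unfolding e_def by (intro norm_linear_le linear_funpow linL)
  ultimately interpret affine_ifs L e D
    by (intro affine_ifs.intro linL) (simp_all add: D_def)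
  have attractor_eq: "self_affine_set A {0, v, of_int k *\<^sub>R (A *v v)} = attractor"
    unfolding attractor_def self_affine_set_def unfolding D_def L_def u_def ..
  define emb where "emb = (\<lambda>(x::int, y::int). of_int x *\<^sub>R v + of_int y *\<^sub>R u)"
  have A_emb: "A *v emb (x, y) = emb (- q * y, x - p * y)" for x y
    by (simp add: emb_def u_def cp matrix_vector_right_distrib
        matrix_vector_mult_scaleR algebra_simps)
  have emb_diff: "emb (x, y) - emb (x', y') = emb (x - x', y - y')" for x y x' y'
    by (simp add: emb_def algebra_simps)
  \<comment> \<open>The seven pairs encode exactly the differences of two digits, so steps in the
    plane become steps on integer pairs.\<close>
  have digits: "(\<exists>d\<in>D. \<exists>d'\<in>D. P (d - d')) \<longleftrightarrow> (\<exists>(a, b)\<in>digit_differences. P (emb (a, k * b)))" for P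
    by (auto simp: D_def digit_differences_def emb_def)
  have ABx: "(\<exists>d\<in>D. \<exists>d'\<in>D. A *v emb (x, y) - (d - d') \<in> X) \<longleftrightarrow>
    (\<exists>(a, b)\<in>digit_differences. emb (- q * y - a, x - p * y - k * b) \<in> X)" for x y X
    using digits[of "\<lambda>z. A *v emb (x, y) - z \<in> X"] by (simp only: A_emb emb_diff)
  have emb_D: "0 = emb (0, 0)" "v = emb (1, 0)" "of_int k *\<^sub>R u = emb (0, k)"
    "of_int k *\<^sub>R u - v = emb (-1, k)"
    by (simp_all add: emb_def)
  have "connected attractor" if k: "k = 1 \<or> k = -1"
  proof -
    obtain S where S: "finite S" "self_covering p q k S" "(1, 0) \<in> S" "(0, k) \<in> S \<or> (-1, k) \<in> S"
      using self_covering_exists[OF adm k] by blast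
    have inE: "emb s \<in> differences" if "s \<in> S" for s
    proof (rule differences_greatest[of "emb ` S"])
      show "bounded (emb ` S)" using S(1) by (simp add: finite_imp_bounded)
      show "emb s \<in> emb ` S" using that by simp
      show "L (A *v x) = x" for x by (rule LA)
      fix w assume "w \<in> emb ` S"
      then obtain x y where xy: "(x, y) \<in> S" "w = emb (x, y)" by auto
      have "\<exists>(a, b)\<in>digit_differences. emb (- q * y - a, x - p * y - k * b) \<in> emb ` S"
        using S(2) xy(1) unfolding self_covering_def by blast
      then show "\<exists>d\<in>D. \<exists>d'\<in>D. A *v w - (d - d') \<in> emb ` S"
        unfolding xy(2) ABx .
    qed
    from S(4) show ?thesis
    proof
      assume "(0, k) \<in> S"
      then show ?thesis
        using inE[of "(0, k)"] inE[of "(1, 0)"] S(3) zero_in_differences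
        by (intro connected_if_star[of 0]) (auto simp: D_def emb_D(2,3)[symmetric])
    next
      assume "(-1, k) \<in> S"
      then show ?thesis
        using inE[of "(-1, k)"] uminus_in_differences[OF inE[of "(1, 0)"]] S(3) zero_in_differences
        by (intro connected_if_star[of v]) (auto simp: D_def emb_D(2,4)[symmetric])
    qed
  qed
  moreover have "\<not> connected attractor" if k: "\<not> (k = 1 \<or> k = -1)"
  proof -
    define \<delta> where "\<delta> = v$1 * u$2 - v$2 * u$1"
    have "\<delta> \<noteq> 0" unfolding \<delta>_def u_def using assms(5,6) by (rule independent_pair_det)
    obtain R where R: "\<And>w. w \<in> differences \<Longrightarrow> norm w \<le> R" using differences_bounded by blast
    \<comment> \<open>By Cramer's rule \<open>y\<close> is a determinant divided by
      \<open>\<delta>\<close>, hence bounded on T - T.\<close>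
    have y_bound: "\<bar>y\<bar> \<le> \<lceil>2 * norm v * R / \<bar>\<delta>\<bar>\<rceil>" if "emb (x, y) \<in> differences" for x y
    proof -
      let ?w = "emb (x, y)"
      have "of_int y * \<delta> = v$1 * ?w$2 - v$2 * ?w$1"
        by (simp add: emb_def \<delta>_def algebra_simps)
      then have "\<bar>of_int y\<bar> * \<bar>\<delta>\<bar> \<le> \<bar>v$1\<bar> * \<bar>?w$2\<bar> + \<bar>v$2\<bar> * \<bar>?w$1\<bar>"
        by (metis abs_mult abs_triangle_ineq4)
      also have "\<dots> \<le> norm v * R + norm v * R"
        by (intro add_mono mult_mono component_le_norm_cart
            order_trans[OF component_le_norm_cart R[OF that]]) simp_all
      finally have "\<bar>of_int y\<bar> \<le> 2 * norm v * R / \<bar>\<delta>\<bar>"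
        using \<open>\<delta> \<noteq> 0\<close> by (simp add: field_simps)
      then have "real_of_int \<bar>y\<bar> \<le> of_int \<lceil>2 * norm v * R / \<bar>\<delta>\<bar>\<rceil>"
        using le_of_int_ceiling[of "2 * norm v * R / \<bar>\<delta>\<bar>"] by linarith
      then show ?thesis by (simp only: of_int_le_iff)
    qed
    have notin: "emb (x0, k) \<notin> differences" if x0: "x0 = 0 \<or> x0 = -1" for x0
    proof
      assume start: "emb (x0, k) \<in> differences"
      \<comment> \<open>Dependent choice yields an infinite orbit inside T - T; the clause for
        \<open>n = 0\<close> pins its starting point.\<close>
      have "\<exists>z. \<forall>n. (emb (z n) \<in> differences \<and> (n = 0 \<longrightarrow> z n = (x0, k))) \<and>
        (\<exists>(a, b)\<in>digit_differences.
          z (Suc n) = (- q * snd (z n) - a, fst (z n) - p * snd (z n) - k * b))"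
      proof (rule dependent_nat_choice)
        show "\<exists>z. emb z \<in> differences \<and> (0 = (0::nat) \<longrightarrow> z = (x0, k))" using start by blast
        fix z and n :: nat assume z: "emb z \<in> differences \<and> (n = 0 \<longrightarrow> z = (x0, k))"
        obtain x y where xy: "z = (x, y)" by (cases z)
        have "\<exists>(a, b)\<in>digit_differences. emb (- q * y - a, x - p * y - k * b) \<in> differences"
          unfolding ABx[symmetric] using z xy
          by (intro differences_step AL) (simp_all add: matrix_vector_mul_linear)
        then show "\<exists>z'. (emb z' \<in> differences \<and> (Suc n = 0 \<longrightarrow> z' = (x0, k))) \<and>
          (\<exists>(a, b)\<in>digit_differences.
            z' = (- q * snd z - a, fst z - p * snd z - k * b))"
          unfolding xy by fastforce
      qed
      then obtain z where zE: "\<And>n. emb (z n) \<in> differences" and z0: "z 0 = (x0, k)"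
        and zs: "\<And>n. \<exists>(a, b)\<in>digit_differences.
          z (Suc n) = (- q * snd (z n) - a, fst (z n) - p * snd (z n) - k * b)"
        by blast
      show False
      proof (rule no_bounded_orbit[OF adm, of k "\<lambda>n. fst (z n)" "\<lambda>n. snd (z n)"])
        show "\<bar>k\<bar> \<ge> 2" using k assms(4) by linarith
        show "\<bar>snd (z n)\<bar> \<le> \<lceil>2 * norm v * R / \<bar>\<delta>\<bar>\<rceil>" for n
          using y_bound[of "fst (z n)" "snd (z n)"] zE by simp
        show "\<exists>(a, b)\<in>digit_differences. fst (z (Suc n)) = - q * snd (z n) - a \<and>
          snd (z (Suc n)) = fst (z n) - p * snd (z n) - k * b" for n
          using zs[of n] by fastforce
      qed (use z0 x0 in simp_all)
    qed
    have "v \<noteq> 0" using \<open>\<delta> \<noteq> 0\<close> by (auto simp: \<delta>_def)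
    show ?thesis
    proof (rule not_connected_if_isolated[of "of_int k *\<^sub>R u"])
      show "of_int k *\<^sub>R u \<in> D" by (simp add: D_def)
      have "0 \<in> D" "v \<in> D" by (simp_all add: D_def)
      then show "D \<noteq> {of_int k *\<^sub>R u}" using \<open>v \<noteq> 0\<close> by auto
      show "inj L" using AL by (metis injI)
      \<comment> \<open>The other digits \<open>0\<close> and \<open>v\<close> correspond to the
        starting points \<open>(0, k)\<close> and \<open>(-1, k)\<close>.\<close>
      show "of_int k *\<^sub>R u - d \<notin> differences" if "d \<in> D" "d \<noteq> of_int k *\<^sub>R u" for d
        using that notin[of 0] notin[of "-1"] by (auto simp: D_def emb_D(3,4)[symmetric])
    qed
  qed
  ultimately show ?thesis unfolding attractor_eq by blast
qed

end
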